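(* Let $n\ge 1$. Let $\mathrm{GL}_n(\mathbb{C})$ act on $\mathbb{C}^n\oplus\mathrm{Sym}_n(\mathbb{C})\oplus\mathrm{Sym}_n(\mathbb{C})$ by $$a\cdot(u,B,C)=(au,\ aB\,{}^t a,\ {}^t a^{-1}Ca^{-1}),$$ and let $\mathrm{GL}_n(\mathbb{C})\times\mathrm{GL}_n(\mathbb{C})$ act on $\mathbb{C}^{2n}\oplus\mathrm{M}_n(\mathbb{C})\oplus\mathrm{M}_n(\mathbb{C})$, where $\mathbb{C}^{2n}=\mathbb{C}^n\oplus\mathbb{C}^n$, by $$(a,b)\cdot((u,v),B,C)=\bigl((au,\ {}^t b^{-1}v),\ aBb^{-1},\ bCa^{-1}\bigr).$$ Then the map $(u,B,C)\mapsto((u,-u),B,C)$ induces an injective map of orbit spaces $$\bigl(\mathbb{C}^n\oplus\mathrm{Sym}_n(\mathbb{C})\oplus\mathrm{Sym}_n(\mathbb{C})\bigr)/\mathrm{GL}_n(\mathbb{C})\hookrightarrow\bigl(\mathbb{C}^{2n}\oplus\mathrm{M}_n(\mathbb{C})\oplus\mathrm{M}_n(\mathbb{C})\bigr)/\bigl(\mathrm{GL}_n(\mathbb{C})\times\mathrm{GL}_n(\mathbb{C})\bigr),$$ sending the $\mathrm{GL}_n(\mathbb{C})$-orbit of a point to the $\mathrm{GL}_n(\mathbb{C})\times\mathrm{GL}_n(\mathbb{C})$-orbit of its image.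
   Context: $\mathrm{M}_n(\mathbb{C})$ is the space of complex $n\times n$ matrices and $\mathrm{Sym}_n(\mathbb{C})$ the subspace of symmetric ones; ${}^t$ denotes transpose. The group homomorphism $\mathrm{GL}_n(\mathbb{C})\to\mathrm{GL}_n(\mathbb{C})\times\mathrm{GL}_n(\mathbb{C})$, $a\mapsto(a,{}^t a^{-1})$, makes the given map equivariant. For a group $H$ acting on a set $M$, $M/H$ denotes the set of $H$-orbits. *)

theory Defs
  imports "HOL-Analysis.Analysis" "HOL-Algebra.Group_Action"
begin

definition GL :: "(complex^'n^'n) monoid" where
  "GL = \<lparr>carrier = {a. invertible a}, mult = (**), one = mat 1\<rparr>"

definition Sym :: "(complex^'n^'n) set" where
  "Sym = {A. transpose A = A}"

definition sym_space :: "((complex^'n) \<times> (complex^'n^'n) \<times> (complex^'n^'n)) set" where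
  "sym_space = UNIV \<times> Sym \<times> Sym"

text \<open>The restriction to \<^const>\<open>sym_space\<close> is only there because \<^const>\<open>group_action\<close>
  requires the action maps to be extensional.\<close>

definition sym_act ::
    "(complex^'n^'n) \<Rightarrow> (complex^'n) \<times> (complex^'n^'n) \<times> (complex^'n^'n)
      \<Rightarrow> (complex^'n) \<times> (complex^'n^'n) \<times> (complex^'n^'n)" where
  "sym_act a = (\<lambda>(u, B, C) \<in> sym_space.
     (a *v u, a ** B ** transpose a, transpose (matrix_inv a) ** C ** matrix_inv a))"

definition pair_act ::
    "(complex^'n^'n) \<times> (complex^'n^'n)
      \<Rightarrow> ((complex^'n) \<times> (complex^'n)) \<times> (complex^'n^'n) \<times> (complex^'n^'n)
      \<Rightarrow> ((complex^'n) \<times> (complex^'n)) \<times> (complex^'n^'n) \<times> (complex^'n^'n)" where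
  "pair_act = (\<lambda>(a, b) ((u, v), B, C).
     ((a *v u, transpose (matrix_inv b) *v v), a ** B ** matrix_inv b, b ** C ** matrix_inv a))"

definition sym_to_pair ::
    "(complex^'n) \<times> (complex^'n^'n) \<times> (complex^'n^'n)
      \<Rightarrow> ((complex^'n) \<times> (complex^'n)) \<times> (complex^'n^'n) \<times> (complex^'n^'n)" where
  "sym_to_pair = (\<lambda>(u, B, C). ((u, - u), B, C))"

lemma matrix_inv_mult_cancel:
  fixes a :: "complex^'n^'n"
  assumes "invertible a"
  shows "a ** matrix_inv a = mat 1" "matrix_inv a ** a = mat 1"
  using assms unfolding invertible_def matrix_inv_def
  by (metis (mono_tags, lifting) someI_ex)+

lemma matrix_inv_eqI:
  fixes a :: "complex^'n^'n"
  assumes "a ** b = mat 1"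
  shows "matrix_inv a = b"
proof -
  have "invertible a"
    using assms invertible_def matrix_left_right_inverse by blast
  then have "matrix_inv a ** (a ** b) = b"
    by (simp add: matrix_mul_assoc matrix_inv_mult_cancel)
  then show ?thesis
    by (simp add: assms)
qed

lemma invertible_matrix_inv:
  fixes a :: "complex^'n^'n"
  shows "invertible a \<Longrightarrow> invertible (matrix_inv a)"
  using matrix_inv_mult_cancel invertible_def by blast

lemma matrix_inv_matrix_inv:
  fixes a :: "complex^'n^'n"
  shows "invertible a \<Longrightarrow> matrix_inv (matrix_inv a) = a"
  by (simp add: matrix_inv_eqI matrix_inv_mult_cancel)

lemma matrix_inv_mat_1: "matrix_inv (mat 1 :: (complex^'n^'n)) = mat 1"
  by (simp add: matrix_inv_eqI)

lemma matrix_inv_mult: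
  fixes a b :: "complex^'n^'n"
  assumes "invertible a" "invertible b"
  shows "matrix_inv (a ** b) = matrix_inv b ** matrix_inv a"
proof (rule matrix_inv_eqI)
  have "a ** b ** (matrix_inv b ** matrix_inv a) = a ** (b ** matrix_inv b) ** matrix_inv a"
    by (simp add: matrix_mul_assoc)
  then show "a ** b ** (matrix_inv b ** matrix_inv a) = mat 1"
    by (simp add: assms matrix_inv_mult_cancel)
qed

lemma matrix_inv_transpose:
  fixes a :: "complex^'n^'n"
  shows "invertible a \<Longrightarrow> matrix_inv (transpose a) = transpose (matrix_inv a)"
  by (rule matrix_inv_eqI)
    (metis matrix_inv_mult_cancel(2) matrix_transpose_mul transpose_mat)

lemma invertible_mat_1: "invertible (mat 1 :: (complex^'n^'n))"
  unfolding invertible_def by (metis matrix_mul_lid)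

lemma group_GL: "group GL"
proof (rule groupI)
  fix a :: "complex^'n^'n"
  assume "a \<in> carrier GL"
  then show "\<exists>b\<in>carrier GL. b \<otimes>\<^bsub>GL\<^esub> a = \<one>\<^bsub>GL\<^esub>"
    using invertible_matrix_inv matrix_inv_mult_cancel by (auto simp: GL_def)
qed (auto simp: GL_def invertible_mult invertible_mat_1 matrix_mul_assoc)

lemma group_action_restrictI:
  assumes G: "group G"
    and closed: "\<And>g x. g \<in> carrier G \<Longrightarrow> x \<in> E \<Longrightarrow> f g x \<in> E"
    and one: "\<And>x. x \<in> E \<Longrightarrow> f \<one>\<^bsub>G\<^esub> x = x"
    and mult: "\<And>g h x. g \<in> carrier G \<Longrightarrow> h \<in> carrier G \<Longrightarrow> x \<in> E
      \<Longrightarrow> f (g \<otimes>\<^bsub>G\<^esub> h) x = f g (f h x)"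
  shows "group_action G E (\<lambda>g. restrict (f g) E)"
proof -
  interpret group G by (rule G)
  have Bij: "restrict (f g) E \<in> Bij E" if g: "g \<in> carrier G" for g
  proof -
    have "bij_betw (f g) E E"
    proof (rule bij_betw_byWitness[where f' = "f (inv\<^bsub>G\<^esub> g)"])
      show "\<forall>x\<in>E. f (inv\<^bsub>G\<^esub> g) (f g x) = x" "\<forall>x\<in>E. f g (f (inv\<^bsub>G\<^esub> g) x) = x"
        using g one mult by (metis inv_closed l_inv r_inv)+
    qed (use g closed in auto)
    then show ?thesis
      by (simp add: Bij_def)
  qed
  have "(\<lambda>g. restrict (f g) E) \<in> hom G (BijGroup E)"
  proof (rule homI)
    fix g h assume gh: "g \<in> carrier G" "h \<in> carrier G"
    have "restrict (f (g \<otimes>\<^bsub>G\<^esub> h)) E = compose E (restrict (f g) E) (restrict (f h) E)"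
      using gh closed mult by (auto simp: compose_def fun_eq_iff)
    then show "restrict (f (g \<otimes>\<^bsub>G\<^esub> h)) E
        = restrict (f g) E \<otimes>\<^bsub>BijGroup E\<^esub> restrict (f h) E"
      using gh Bij by (simp add: BijGroup_def)
  qed (use Bij in \<open>simp add: BijGroup_def\<close>)
  then show ?thesis
    unfolding group_action_def group_hom_def group_hom_axioms_def
    using G group_BijGroup by blast
qed

lemma group_action_sym_act: "group_action GL sym_space sym_act"
  unfolding sym_act_def
  by (rule group_action_restrictI[OF group_GL])
    (auto simp: GL_def sym_space_def Sym_def matrix_transpose_mul matrix_mul_assoc
      matrix_vector_mul_assoc matrix_inv_mult matrix_inv_mat_1 transpose_mat)

lemma group_action_pair_act: "group_action (GL \<times>\<times> GL) UNIV pair_act"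
proof -
  have "group_action (GL \<times>\<times> GL) UNIV (\<lambda>g. restrict (pair_act g) UNIV)"
    by (rule group_action_restrictI[OF DirProd_group[OF group_GL group_GL]])
      (auto simp: GL_def pair_act_def DirProd_def matrix_transpose_mul matrix_mul_assoc
        matrix_vector_mul_assoc matrix_inv_mult matrix_inv_mat_1 transpose_mat
        simp del: transpose_matrix_vector)
  then show ?thesis
    by (simp add: restrict_def)
qed

lemma sym_to_pair_equivariant:
  assumes "a \<in> carrier GL" "x \<in> sym_space"
  shows "sym_to_pair (sym_act a x) = pair_act (a, transpose (matrix_inv a)) (sym_to_pair x)"
proof -
  have "a *v (- u) = - (a *v u)" for u
    by (metis add.right_neutral diff_0 matrix_vector_mult_0_right matrix_vector_mult_diff_distrib)
  moreover have "invertible a"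
    using assms by (simp add: GL_def)
  then have "matrix_inv (transpose (matrix_inv a)) = transpose a"
    by (simp add: matrix_inv_transpose invertible_matrix_inv matrix_inv_matrix_inv)
  ultimately show ?thesis
    using assms
    by (cases x) (auto simp: sym_to_pair_def sym_act_def pair_act_def simp del: transpose_matrix_vector)
qed

end

theory Submission
  imports Defs "HOL-Computational_Algebra.Fundamental_Theorem_Algebra"
begin

text \<open>
  The map on orbits is well defined by equivariance (lemma \<open>sym_to_pair_equivariant\<close>).  The content
  of the theorem is its injectivity: two points of the symmetric space whose images are related by
  some pair \<open>(a, b)\<close> are already related by a single matrix.  Put \<open>h = \<^sup>tb a\<close>.  Symmetry
  of the matrices of both points gives \<open>h B = B \<^sup>th\<close> and \<open>\<^sup>th C = C h\<close>, and \<open>h u = u\<close> because both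
  \<open>a u\<close> and \<open>\<^sup>tb\<^sup>-\<^sup>1 u\<close> are the vector of the second point.  So \<open>h\<close> measures how far
  \<open>(a, b)\<close> is from the subgroup of pairs \<open>(g, \<^sup>tg\<^sup>-\<^sup>1)\<close>, and it can be absorbed by a square root: if
  \<open>s\<^sup>2 = h\<close> and \<open>s\<close> satisfies the same three relations as \<open>h\<close>, then \<open>g = a s\<^sup>-\<^sup>1\<close> carries the first
  point to the second.

  The first two relations pass from \<open>h\<close> to every polynomial in \<open>h\<close>, so \<open>s\<close> is sought in the form
  \<open>p(h)\<close>.  Then \<open>s u = p(1) u\<close>, and since \<open>s\<^sup>2 u = u\<close>, one of \<open>p\<close> and \<open>-p\<close> fixes \<open>u\<close>.  It
  remains to see that an invertible complex matrix has a square root that is a polynomial in it.  The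
  matrix is annihilated by a polynomial \<open>q\<close> with \<open>q(0) \<noteq> 0\<close>, and for such \<open>q\<close> the variable \<open>X\<close> is
  a square modulo \<open>q\<close>.  This is built up one linear factor of \<open>q\<close> at a time
  (lemma \<open>square_root_of_X_mod\<close>).
\<close>

section \<open>Square roots modulo a polynomial\<close>

text \<open>
  If \<open>p\<^sup>2 - X = q m\<close>, replacing \<open>p\<close> by \<open>p + t q\<close> for a constant \<open>t\<close> multiplies \<open>q\<close> by
  \<open>m + 2 t p + t\<^sup>2 q\<close> instead of \<open>m\<close>.  Gaining a further factor \<open>X - r\<close> therefore means solving
  \<open>q(r) t\<^sup>2 + 2 p(r) t + m(r) = 0\<close>.  If \<open>q(r) = 0\<close> this equation is linear, and its leading
  coefficient does not vanish because \<open>p(r)\<^sup>2 = r \<noteq> 0\<close>.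
\<close>

lemma square_root_of_X_mod_step:
  fixes p q :: "complex poly"
  assumes "q dvd p * p - [:0, 1:]" and r: "r \<noteq> 0"
  shows "\<exists>p'. [:- r, 1:] * q dvd p' * p' - [:0, 1:]"
proof -
  obtain m where m: "p * p - [:0, 1:] = q * m"
    using assms by blast
  have "\<exists>t. poly q r * t\<^sup>2 + 2 * poly p r * t + poly m r = 0"
  proof (cases "poly q r = 0")
    case True
    have "poly p r * poly p r - r = poly q r * poly m r"
      using arg_cong[OF m, of "\<lambda>f. poly f r"] by simp
    with True r have "poly p r \<noteq> 0"
      by auto
    then show ?thesis
      using True by (intro exI[of _ "- poly m r / (2 * poly p r)"]) simp
  next
    case False
    define d where "d = csqrt ((poly p r)\<^sup>2 - poly q r * poly m r)"
    define t where "t = (d - poly p r) / poly q r"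
    have "d\<^sup>2 = (poly p r)\<^sup>2 - poly q r * poly m r"
      by (simp add: d_def)
    moreover have "d = poly q r * t + poly p r"
      using False by (simp add: t_def)
    ultimately have "poly q r * (poly q r * t\<^sup>2 + 2 * poly p r * t + poly m r) = 0"
      by algebra
    with False show ?thesis
      by auto
  qed
  then obtain t where "poly (m + smult (2 * t) p + smult (t * t) q) r = 0"
    by (auto simp: power2_eq_square algebra_simps)
  then obtain k where k: "m + smult (2 * t) p + smult (t * t) q = [:- r, 1:] * k"
    unfolding poly_eq_0_iff_dvd by (elim dvdE)
  define T where "T = [:t:]"
  have quadratic: "smult (2 * t) p + smult (t * t) q = (T + T) * p + T * T * q"
    by (simp add: T_def smult_add_left [symmetric])
  have "(p + T * q) * (p + T * q) - [:0, 1:]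
      = (p * p - [:0, 1:]) + q * (smult (2 * t) p + smult (t * t) q)"
    unfolding quadratic by algebra
  also have "\<dots> = q * (m + smult (2 * t) p + smult (t * t) q)"
    by (simp only: m distrib_left add.assoc)
  also have "\<dots> = [:- r, 1:] * q * k"
    by (simp only: k mult.left_commute mult.assoc)
  finally show ?thesis
    by (metis dvd_triv_left)
qed

lemma square_root_of_X_mod:
  fixes q :: "complex poly"
  assumes "poly q 0 \<noteq> 0"
  shows "\<exists>p. q dvd p * p - [:0, 1:]"
  using assms
proof (induction "degree q" arbitrary: q)
  case 0
  then obtain c where c: "q = [:c:]"
    by (metis degree_eq_zeroE)
  then have "is_unit q"
    using "0.prems" by (simp add: is_unit_pCons_iff)
  then show ?case
    by (blast intro: unit_imp_dvd)
next
  case (Suc n)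
  then have "\<not> constant (poly q)"
    by (simp add: constant_degree)
  then obtain r where r: "poly q r = 0"
    using fundamental_theorem_of_algebra by blast
  then obtain q' where q': "q = [:- r, 1:] * q'"
    by (auto simp: poly_eq_0_iff_dvd)
  have "q' \<noteq> 0"
    using Suc.prems q' by auto
  then have "degree q = Suc (degree q')"
    unfolding q' by (subst degree_mult_eq) auto
  moreover have "poly q' 0 \<noteq> 0" "r \<noteq> 0"
    using Suc.prems q' by auto
  ultimately show ?case
    using Suc.hyps square_root_of_X_mod_step q' by (metis nat.inject)
qed

section \<open>Polynomials in a matrix\<close>

text \<open>
  Horner's scheme, as in the library's \<^const>\<open>poly\<close>, which cannot be used itself because \<open>*\<close> on the
  type of square matrices is the entrywise product.
\<close>

definition mat_poly :: "'a::comm_ring_1 poly \<Rightarrow> 'a^'n^'n \<Rightarrow> 'a^'n^'n" where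
  "mat_poly p A = fold_coeffs (\<lambda>c M. mat c + A ** M) p 0"

lemma mat_poly_0 [simp]: "mat_poly 0 A = 0"
  by (simp add: mat_poly_def)

lemma mat_poly_pCons [simp]: "mat_poly (pCons c p) A = mat c + A ** mat_poly p A"
  by (cases "p = 0 \<and> c = 0") (auto simp: mat_poly_def)

lemma mat_add: "mat (c + d) = mat c + (mat d :: 'a::comm_ring_1^'n^'n)"
  by (simp add: mat_def vec_eq_iff)

lemma matrix_add_rdistrib: "(B + C) ** (A :: 'a::semiring_1^'n^'m) = B ** A + C ** A"
  by (simp add: matrix_matrix_mult_def vec_eq_iff sum.distrib distrib_right)

lemma mat_matrix_mult_nth: "(mat c ** (M :: 'a::comm_ring_1^'n^'m)) $ i $ j = c * M $ i $ j"
  by (simp add: mat_def matrix_matrix_mult_def if_distrib[of "\<lambda>x. x * y" for y] cong: if_cong)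

lemma matrix_mat_mult_nth: "((M :: 'a::comm_ring_1^'n^'m) ** mat c) $ i $ j = c * M $ i $ j"
  by (simp add: mat_def matrix_matrix_mult_def if_distrib[of "\<lambda>x. y * x" for y] mult.commute
      cong: if_cong)

lemma mat_commute: "mat c ** M = (M :: 'a::comm_ring_1^'n^'m) ** mat c"
  by (simp add: vec_eq_iff mat_matrix_mult_nth matrix_mat_mult_nth)

lemma mat_mult: "mat (c * d) = mat c ** (mat d :: 'a::comm_ring_1^'n^'n)"
  by (simp add: vec_eq_iff mat_matrix_mult_nth) (simp add: mat_def)

lemma mat_poly_add: "mat_poly (p + q) A = mat_poly p A + mat_poly q A"
proof (induction p arbitrary: q)
  case (pCons c p)
  then show ?case
    by (cases q) (simp add: mat_add matrix_add_ldistrib)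
qed simp

lemma mat_poly_smult: "mat_poly (smult c p) A = mat c ** mat_poly p A"
proof (induction p)
  case (pCons d p)
  have "A ** (mat c ** mat_poly p A) = mat c ** (A ** mat_poly p A)"
    by (metis mat_commute matrix_mul_assoc)
  with pCons show ?case
    by (simp add: mat_mult matrix_add_ldistrib)
qed simp

lemma mat_poly_uminus: "mat_poly (- p) A = - mat_poly p A"
  using mat_poly_add[of p "- p" A] by (simp add: eq_neg_iff_add_eq_0 add.commute)

lemma mat_poly_diff: "mat_poly (p - q) A = mat_poly p A - mat_poly q A"
  using mat_poly_add[of p "- q" A] by (simp add: mat_poly_uminus)

lemma mat_poly_mult: "mat_poly (p * q) A = mat_poly p A ** mat_poly q A"
  by (induction p)
    (simp_all add: mat_poly_add mat_poly_smult matrix_add_rdistrib matrix_mul_assoc)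

lemma mat_poly_sum: "mat_poly (\<Sum>i\<in>I. f i) A = (\<Sum>i\<in>I. mat_poly (f i) A)"
  by (induction I rule: infinite_finite_induct) (simp_all add: mat_poly_add)

lemma transpose_add: "transpose (A + B) = transpose A + transpose B"
  by (simp add: transpose_def vec_eq_iff)

lemma mat_poly_intertwine:
  assumes "A ** B = B ** A'"
  shows "mat_poly p A ** B = B ** mat_poly p A'"
proof (induction p)
  case (pCons c p)
  have "A ** mat_poly p A ** B = B ** (A' ** mat_poly p A')"
    by (metis assms matrix_mul_assoc pCons.IH)
  then show ?case
    by (simp add: matrix_add_ldistrib matrix_add_rdistrib mat_commute)
qed simp

lemma transpose_mat_poly: "transpose (mat_poly p A) = mat_poly p (transpose A)"
proof (induction p)
  case (pCons c p)
  have "mat_poly p (transpose A) ** transpose A = transpose A ** mat_poly p (transpose A)"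
    by (rule mat_poly_intertwine) simp
  with pCons show ?case
    by (simp add: transpose_add matrix_transpose_mul)
qed (simp add: transpose_def vec_eq_iff)

lemma mat_poly_fixed_vector:
  fixes A :: "'a::field^'n^'n"
  assumes "A *v u = u"
  shows "mat_poly p A *v u = poly p 1 *s u"
proof (induction p)
  case (pCons c p)
  have "mat c *v u = c *s u"
    by (simp add: mat_def matrix_vector_mult_def vec_eq_iff if_distrib[of "\<lambda>x. x * y" for y]
        cong: if_cong)
  moreover have "A *v (poly p 1 *s u) = poly p 1 *s u"
    using assms by (simp add: vector_scalar_commute)
  ultimately show ?case
    using pCons
    by (simp add: matrix_vector_mult_add_rdistrib matrix_vector_mul_assoc [symmetric]
        vector_sadd_rdistrib)
qed simp

section \<open>Polynomial square roots of invertible matrices\<close>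

text \<open>
  The powers of \<open>A\<close> lie in a finite-dimensional space.  Dependence over the reals is enough, so
  that the dimension theory of Euclidean spaces applies.
\<close>

lemma annihilating_polynomial:
  fixes A :: "complex^'n^'n"
  shows "\<exists>q. q \<noteq> 0 \<and> mat_poly q A = 0"
proof -
  define P where "P k = mat_poly (monom 1 k) A" for k
  show ?thesis
  proof (cases "inj P")
    case False
    \<comment> \<open>A coincidence of two powers is invisible in the set of powers, which may be independent.\<close>
    then obtain i j where "P i = P j" "i \<noteq> j"
      by (auto simp: inj_def)
    then show ?thesis
      by (intro exI[of _ "monom 1 i - monom 1 j"]) (auto simp: P_def mat_poly_diff monom_eq_iff')
  next
    case True
    then have "dependent (range P)"
      by (intro dependent_biggerset) (simp add: range_inj_infinite)
    then obtain T u v where T: "finite T" "T \<subseteq> range P" and v: "v \<in> T" "u v \<noteq> 0"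
      and sum: "(\<Sum>w\<in>T. u w *\<^sub>R w) = 0"
      unfolding dependent_explicit by blast
    define q where "q = (\<Sum>w\<in>T. monom (of_real (u w) :: complex) (inv_into UNIV P w))"
    have inv_P: "inv_into UNIV P w = inv_into UNIV P v \<longleftrightarrow> w = v" if "w \<in> T" for w
      using that T v by (metis f_inv_into_f subsetD)
    have "coeff q (inv_into UNIV P v) = (\<Sum>w\<in>T. if w = v then of_real (u w) else 0)"
      unfolding q_def coeff_sum by (intro sum.cong) (simp_all add: inv_P)
    also have "\<dots> \<noteq> 0"
      using T v by simp
    finally have "q \<noteq> 0"
      by auto
    moreover have "mat_poly (monom (of_real (u w)) (inv_into UNIV P w)) A = u w *\<^sub>R w" if "w \<in> T" for w
    proof -
      have "mat_poly (monom 1 (inv_into UNIV P w)) A = w"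
        using that T by (metis P_def f_inv_into_f subsetD)
      then have "mat_poly (smult (of_real (u w)) (monom 1 (inv_into UNIV P w))) A = mat (of_real (u w)) ** w"
        by (simp only: mat_poly_smult)
      then show ?thesis
        by (simp add: smult_monom vec_eq_iff mat_matrix_mult_nth) (simp add: scaleR_conv_of_real)
    qed
    then have "mat_poly q A = 0"
      using sum by (simp add: q_def mat_poly_sum)
    ultimately show ?thesis
      by blast
  qed
qed

text \<open>For invertible \<open>A\<close>, factors \<open>X\<close> can be cancelled from an annihilating polynomial.\<close>

lemma annihilating_polynomial_nonzero_at_0:
  fixes A :: "complex^'n^'n"
  assumes "invertible A"
  shows "\<exists>q. poly q 0 \<noteq> 0 \<and> mat_poly q A = 0"
proof -
  have "\<exists>q'. poly q' 0 \<noteq> 0 \<and> mat_poly q' A = 0" if "q \<noteq> 0" "mat_poly q A = 0" for q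
    using that
  proof (induction q)
    case (pCons c q)
    show ?case
    proof (cases "c = 0")
      case True
      then have "A ** mat_poly q A = 0"
        using pCons.prems by simp
      then have "matrix_inv A ** A ** mat_poly q A = 0"
        by (metis matrix_mul_assoc times0_right)
      then have "mat_poly q A = 0"
        by (simp add: assms matrix_inv_mult_cancel)
      then show ?thesis
        using True pCons by auto
    next
      case False
      then show ?thesis
        using pCons.prems by (intro exI[of _ "pCons c q"]) simp
    qed
  qed simp
  then show ?thesis
    using annihilating_polynomial by blast
qed

lemma matrix_square_root_polynomial:
  fixes A :: "complex^'n^'n"
  assumes "invertible A"
  shows "\<exists>p. mat_poly p A ** mat_poly p A = A"
proof -
  obtain q where q: "poly q 0 \<noteq> 0" "mat_poly q A = 0"
    using annihilating_polynomial_nonzero_at_0[OF assms] by blast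
  then obtain p where "q dvd p * p - [:0, 1:]"
    using square_root_of_X_mod by blast
  then obtain m where "p * p - [:0, 1:] = q * m"
    by blast
  then have "mat_poly (p * p - [:0, 1:]) A = 0"
    using q by (simp add: mat_poly_mult)
  then show ?thesis
    by (auto simp: mat_poly_diff mat_poly_mult)
qed

text \<open>Changing the sign of the polynomial gives control over one fixed vector.\<close>

lemma matrix_square_root_polynomial_fixing:
  fixes A :: "complex^'n^'n"
  assumes "invertible A" and u: "A *v u = u"
  shows "\<exists>p. mat_poly p A ** mat_poly p A = A \<and> mat_poly p A *v u = u"
proof -
  obtain p where p: "mat_poly p A ** mat_poly p A = A"
    using matrix_square_root_polynomial[OF assms(1)] by blast
  have "(poly p 1 * poly p 1) *s u = mat_poly (p * p) A *v u"
    by (simp add: mat_poly_fixed_vector[OF u])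
  also have "\<dots> = u"
    by (simp add: mat_poly_mult p u)
  finally have "(poly p 1 * poly p 1) *s u = 1 *s u"
    by simp
  then have "u = 0 \<or> poly p 1 * poly p 1 = 1"
    unfolding vector_mul_rcancel by blast
  then consider "u = 0" | "poly p 1 = 1" | "poly p 1 = - 1"
    using square_eq_1_iff by blast
  then show ?thesis
  proof cases
    case 3
    have "mat_poly (- p) A ** mat_poly (- p) A = A"
      using p by (simp flip: mat_poly_mult)
    moreover have "mat_poly (- p) A *v u = u"
      using 3 by (simp add: mat_poly_fixed_vector[OF u])
    ultimately show ?thesis
      by blast
  next
    case 1
    then have "mat_poly p A *v u = u"
      by simp
    with p show ?thesis
      by blast
  next
    case 2
    then have "mat_poly p A *v u = u"
      by (simp add: mat_poly_fixed_vector[OF u])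
    with p show ?thesis
      by blast
  qed
qed

section \<open>Comparison of orbits\<close>

lemma invertible_transpose:
  fixes a :: "complex^'n^'n"
  assumes "invertible a"
  shows "invertible (transpose a)"
  unfolding invertible_def
  by (intro exI[of _ "transpose (matrix_inv a)"])
    (simp add: assms matrix_inv_mult_cancel flip: matrix_transpose_mul)

text \<open>
  The matrix is \<open>g = a s\<^sup>-\<^sup>1\<close> with \<open>s\<close> a square root of \<open>h = \<^sup>tb a\<close>.  For instance
  \<open>g B \<^sup>tg = a s\<^sup>-\<^sup>2 B \<^sup>ta = \<^sup>tb\<^sup>-\<^sup>1 B \<^sup>ta\<close>, and this is the transpose of the symmetric matrix \<open>a B b\<^sup>-\<^sup>1\<close>.
\<close>

lemma sym_related_if_pair_related:
  fixes a b B C :: "complex^'n^'n"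
  assumes a: "invertible a" and b: "invertible b"
    and B: "transpose B = B" and C: "transpose C = C"
    and symB: "transpose (a ** B ** matrix_inv b) = a ** B ** matrix_inv b"
    and symC: "transpose (b ** C ** matrix_inv a) = b ** C ** matrix_inv a"
    and u: "transpose (matrix_inv b) *v u = a *v u"
  shows "\<exists>g. invertible g \<and> g *v u = a *v u \<and> g ** B ** transpose g = a ** B ** matrix_inv b
    \<and> transpose (matrix_inv g) ** C ** matrix_inv g = b ** C ** matrix_inv a"
proof -
  define h where "h = transpose b ** a"
  let ?a' = "matrix_inv a" and ?b' = "matrix_inv b"
  note inv = matrix_inv_mult_cancel[OF a] matrix_inv_mult_cancel[OF b]
  have tb: "transpose b ** transpose ?b' = mat 1" "transpose ?b' ** transpose b = mat 1"
    by (metis inv matrix_transpose_mul transpose_mat)+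
  have ta: "transpose a ** transpose ?a' = mat 1" "transpose ?a' ** transpose a = mat 1"
    by (metis inv matrix_transpose_mul transpose_mat)+
  have h: "invertible h"
    unfolding h_def using a b by (simp add: invertible_mult invertible_transpose)
  have symB': "transpose ?b' ** B ** transpose a = a ** B ** ?b'"
    using symB B by (simp add: matrix_transpose_mul matrix_mul_assoc)
  have symC': "transpose ?a' ** C ** transpose b = b ** C ** ?a'"
    using symC C by (simp add: matrix_transpose_mul matrix_mul_assoc)
  \<comment> \<open>\<open>h B = \<^sup>tb (a B b\<^sup>-\<^sup>1) b\<close>, and the matrix in parentheses may be replaced by its transpose.\<close>
  have "h ** B = transpose b ** (a ** B ** ?b') ** b"
    unfolding h_def by (metis inv(4) matrix_mul_assoc matrix_mul_rid)
  also have "\<dots> = B ** transpose h"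
    unfolding h_def symB' [symmetric]
    by (simp add: matrix_transpose_mul matrix_mul_assoc tb)
  finally have hB: "h ** B = B ** transpose h" .
  have "transpose h ** C = transpose a ** (b ** C ** ?a') ** a"
    unfolding h_def
    by (simp add: matrix_transpose_mul) (metis inv(2) matrix_mul_assoc matrix_mul_rid)
  also have "\<dots> = C ** h"
    unfolding h_def symC' [symmetric] by (simp add: matrix_mul_assoc ta)
  finally have hC: "transpose h ** C = C ** h" .
  have hu: "h *v u = u"
    unfolding h_def by (metis matrix_vector_mul_assoc matrix_vector_mul_lid tb(1) u)
  obtain p where p: "mat_poly p h ** mat_poly p h = h" "mat_poly p h *v u = u"
    using matrix_square_root_polynomial_fixing[OF h hu] by blast
  define s where "s = mat_poly p h"
  let ?s' = "matrix_inv s"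
  have ss: "s ** s = h" and su: "s *v u = u"
    using p by (simp_all add: s_def)
  have s: "invertible s"
    using h ss by (metis invertible_def matrix_left_right_inverse matrix_mul_assoc)
  note sinv = matrix_inv_mult_cancel[OF s]
  have sB: "s ** B = B ** transpose s"
    unfolding s_def transpose_mat_poly by (rule mat_poly_intertwine[OF hB])
  have sC: "transpose s ** C = C ** s"
    unfolding s_def transpose_mat_poly by (rule mat_poly_intertwine[OF hC])
  have ts: "transpose s ** transpose ?s' = mat 1"
    by (metis sinv(2) matrix_transpose_mul transpose_mat)
  define g where "g = a ** ?s'"
  have g': "matrix_inv g = s ** ?a'"
    unfolding g_def by (simp add: a s matrix_inv_mult invertible_matrix_inv matrix_inv_matrix_inv)
  have g: "invertible g"
    unfolding g_def by (simp add: a s invertible_mult invertible_matrix_inv)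
  have gu: "g *v u = a *v u"
    unfolding g_def by (metis su sinv(2) matrix_vector_mul_assoc matrix_vector_mul_lid)
  have "?s' ** B = ?s' ** (B ** transpose s) ** transpose ?s'"
    by (metis ts matrix_mul_assoc matrix_mul_rid)
  also have "\<dots> = B ** transpose ?s'"
    by (metis sB sinv(2) matrix_mul_assoc matrix_mul_lid)
  finally have s'B: "?s' ** B = B ** transpose ?s'" .
  have "transpose ?b' ** s ** s = a"
    by (metis ss h_def tb(2) matrix_mul_assoc matrix_mul_lid)
  then have b': "transpose ?b' = a ** ?s' ** ?s'"
    by (metis sinv(1) matrix_mul_assoc matrix_mul_rid)
  have "g ** B ** transpose g = a ** ?s' ** (B ** transpose ?s') ** transpose a"
    by (simp add: g_def matrix_transpose_mul matrix_mul_assoc)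
  also have "\<dots> = transpose ?b' ** B ** transpose a"
    by (simp add: b' flip: s'B) (simp add: matrix_mul_assoc)
  finally have gB: "g ** B ** transpose g = a ** B ** ?b'"
    by (simp only: symB')
  have "transpose s ** transpose s = transpose h"
    by (simp only: ss matrix_transpose_mul [symmetric])
  then have th: "transpose s ** transpose s = transpose a ** b"
    by (simp only: h_def matrix_transpose_mul transpose_transpose)
  have "transpose (matrix_inv g) ** C ** matrix_inv g = transpose ?a' ** transpose s ** (C ** s) ** ?a'"
    by (simp add: g' matrix_transpose_mul matrix_mul_assoc)
  also have "\<dots> = transpose ?a' ** (transpose s ** transpose s) ** C ** ?a'"
    by (simp add: matrix_mul_assoc flip: sC)
  also have "\<dots> = b ** C ** ?a'"
    by (simp add: th matrix_mul_assoc ta)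
  finally show ?thesis
    using g gu gB by blast
qed

lemma orbit_sym_act_if_orbit_pair_act:
  assumes x: "x \<in> sym_space" and y: "y \<in> sym_space"
    and rel: "sym_to_pair y \<in> orbit (GL \<times>\<times> GL) pair_act (sym_to_pair x)"
  shows "y \<in> orbit GL sym_act x"
proof -
  obtain u B C where x_eq: "x = (u, B, C)" and BC: "transpose B = B" "transpose C = C"
    using x by (auto simp: sym_space_def Sym_def)
  obtain u' B' C' where y_eq: "y = (u', B', C')" and BC': "transpose B' = B'" "transpose C' = C'"
    using y by (auto simp: sym_space_def Sym_def)
  obtain a b where ab: "invertible a" "invertible b"
    and "sym_to_pair y = pair_act (a, b) (sym_to_pair x)"
    using rel by (auto simp: orbit_def GL_def DirProd_def)
  then have u': "u' = a *v u" and v: "- u' = transpose (matrix_inv b) *v (- u)"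
    and B': "B' = a ** B ** matrix_inv b" and C': "C' = b ** C ** matrix_inv a"
    unfolding x_eq y_eq sym_to_pair_def pair_act_def prod.case prod.inject by blast+
  \<comment> \<open>Both copies of \<open>u\<close> are moved to the same vector: the signs in \<open>(u, -u)\<close> cancel.\<close>
  have "transpose (matrix_inv b) *v (- u) = - (transpose (matrix_inv b) *v u)"
    by (metis add.right_neutral diff_0 matrix_vector_mult_0_right matrix_vector_mult_diff_distrib)
  then have "transpose (matrix_inv b) *v u = a *v u"
    using u' v by (metis neg_equal_iff_equal)
  then obtain g where "invertible g" "g *v u = u'" "g ** B ** transpose g = B'"
    "transpose (matrix_inv g) ** C ** matrix_inv g = C'"
    using sym_related_if_pair_related[OF ab BC] BC' u' B' C' by metis
  then have "g \<in> carrier GL" "sym_act g x = y"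
    using x by (simp_all add: GL_def sym_act_def x_eq y_eq)
  then show ?thesis
    by (auto simp: orbit_def)
qed

lemma orbit_pair_act_if_orbit_sym_act:
  assumes "x \<in> sym_space" "y \<in> orbit GL sym_act x"
  shows "sym_to_pair y \<in> orbit (GL \<times>\<times> GL) pair_act (sym_to_pair x)"
proof -
  obtain a where a: "a \<in> carrier GL" "y = sym_act a x"
    using assms by (auto simp: orbit_def)
  then have "(a, transpose (matrix_inv a)) \<in> carrier (GL \<times>\<times> GL)"
    by (simp add: GL_def DirProd_def invertible_transpose invertible_matrix_inv)
  with a assms show ?thesis
    by (auto simp: orbit_def sym_to_pair_equivariant)
qed

lemma (in group_action) orbit_eq_iff:
  assumes "x \<in> E" "y \<in> E"
  shows "orbit G \<phi> x = orbit G \<phi> y \<longleftrightarrow> y \<in> orbit G \<phi> x"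
proof
  assume y: "y \<in> orbit G \<phi> x"
  have "orbit G \<phi> z \<subseteq> E" if "z \<in> E" for z
    using that element_image by (auto simp: orbit_def)
  with assms y show "orbit G \<phi> x = orbit G \<phi> y"
    by (meson orbit_sym orbit_trans subset_antisym subsetD subsetI)
qed (use assms orbit_refl in blast)

theorem corollary1p2:
  shows "\<exists>F \<in> orbits (GL :: (complex^'n^'n) monoid) sym_space sym_act
              \<rightarrow> orbits ((GL :: (complex^'n^'n) monoid) \<times>\<times> (GL :: (complex^'n^'n) monoid)) UNIV pair_act.
           (\<forall>x \<in> sym_space. F (orbit GL sym_act x) = orbit (GL \<times>\<times> GL) pair_act (sym_to_pair x)) \<and>
           inj_on F (orbits (GL :: (complex^'n^'n) monoid) sym_space sym_act)"
proof -
  let ?P = "\<lambda>x :: (complex^'n) \<times> (complex^'n^'n) \<times> (complex^'n^'n).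
    orbit (GL \<times>\<times> GL) pair_act (sym_to_pair x)"
  let ?S = "\<lambda>x :: (complex^'n) \<times> (complex^'n^'n) \<times> (complex^'n^'n). orbit GL sym_act x"
  interpret S: group_action "GL :: (complex^'n^'n) monoid" sym_space sym_act
    by (rule group_action_sym_act)
  interpret P: group_action "(GL :: (complex^'n^'n) monoid) \<times>\<times> (GL :: (complex^'n^'n) monoid)"
      UNIV pair_act
    by (rule group_action_pair_act)
  have eq_iff: "?P x = ?P y \<longleftrightarrow> ?S x = ?S y" if "x \<in> sym_space" "y \<in> sym_space" for x y
    using that S.orbit_eq_iff P.orbit_eq_iff orbit_sym_act_if_orbit_pair_act
      orbit_pair_act_if_orbit_sym_act by (metis UNIV_I)
  define F where "F orb = ?P (SOME x. x \<in> sym_space \<and> ?S x = orb)" for orb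
  have F: "F (?S x) = ?P x" if "x \<in> sym_space" for x
    unfolding F_def using someI[of "\<lambda>y. y \<in> sym_space \<and> ?S y = ?S x" x] that eq_iff by blast
  have "F \<in> orbits GL sym_space sym_act \<rightarrow> orbits (GL \<times>\<times> GL) UNIV pair_act"
    using F by (fastforce simp only: orbits_def)
  moreover have "inj_on F (orbits GL sym_space sym_act)"
    by (auto simp: orbits_def inj_on_def F eq_iff)
  ultimately show ?thesis
    using F by blast
qed

end
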